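(* Let $G=(V,E)$ be a finite graph, let $A,B,C\subseteq E$ be chosen independently and uniformly at random and let $\Delta$ be the event that $A\bigtriangleup B$ and $B\bigtriangleup C$ are both eulerian. Then $$\mathrm{Bias}(|A|+|B|+|C|\equiv 1\ (\mathrm{mod}\ 3)\mid\Delta)=\mathrm{Bias}(|A|+|B|+|C|\equiv 2\ (\mathrm{mod}\ 3)\mid\Delta)$$ and $$\frac{\mathrm{Bias}(|A|+|B|+|C|\equiv 0\ (\mathrm{mod}\ 3)\mid\Delta)-\mathrm{Bias}(|A|+|B|+|C|\equiv 1\ (\mathrm{mod}\ 3)\mid\Delta)}{\mathrm{Bias}(|A|+|B|+|C|\equiv 0\ (\mathrm{mod}\ 3))-\mathrm{Bias}(|A|+|B|+|C|\equiv 1\ (\mathrm{mod}\ 3))}=4^{r(G)}(-3)^{n(G)}\,T\!\left(G;-2,-\tfrac{1}{3}\right).$$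
   Context: Graphs are finite; loops and parallel edges are permitted. A subset $A\subseteq E$ is identified with the subgraph $(V,A)$ of $G$; it is called eulerian if all its vertex degrees are even (a loop contributes 2 to the degree). $\bigtriangleup$ is symmetric difference of sets. For $A\subseteq E$, $r(A)=|V|-k(A)$, where $k(A)$ is the number of connected components of $(V,A)$; $r(G)=r(E)$ and $n(G)=|E|-r(G)$. The Tutte polynomial is $T(G;x,y)=\sum_{A\subseteq E}(x-1)^{r(E)-r(A)}(y-1)^{|A|-r(A)}$. For an event $\Sigma$, $\mathrm{Bias}(\Sigma)=\mathbb{P}(\Sigma)-\mathbb{P}(\overline{\Sigma})$ and $\mathrm{Bias}(\Sigma\mid\Delta)=\mathbb{P}(\Sigma\mid\Delta)-\mathbb{P}(\overline{\Sigma}\mid\Delta)$, where $\overline{\Sigma}$ is the complement of $\Sigma$. *)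

theory Defs
  imports
    "HOL-Probability.Probability"
    "HOL-Library.Uprod"
    "HOL-Number_Theory.Cong"
begin

text \<open>
  Undirected multigraphs. The ends of an edge form an unordered pair, so a loop at \<open>v\<close> has
  ends \<open>Upair v v\<close>, and parallel edges are distinct elements of \<open>edges\<close> with the same ends.
\<close>

record ('v, 'e) multigraph =
  verts :: "'v set"
  edges :: "'e set"
  ends :: "'e \<Rightarrow> 'v uprod"

locale finite_multigraph =
  fixes G :: "('v, 'e) multigraph"
  assumes finite_verts: "finite (verts G)"
    and finite_edges: "finite (edges G)"
    and ends_in_verts: "e \<in> edges G \<Longrightarrow> set_uprod (ends G e) \<subseteq> verts G"

text \<open>Below, a set of edges \<open>A\<close> stands for the spanning subgraph with all vertices of \<open>G\<close>.\<close>

definition incidence :: "('v, 'e) multigraph \<Rightarrow> 'e \<Rightarrow> 'v \<Rightarrow> nat" where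
  "incidence G e v =
     (if ends G e = Upair v v then 2 else if v \<in> set_uprod (ends G e) then 1 else 0)"

definition degree :: "('v, 'e) multigraph \<Rightarrow> 'e set \<Rightarrow> 'v \<Rightarrow> nat" where
  "degree G A v = (\<Sum>e\<in>A. incidence G e v)"

definition eulerian :: "('v, 'e) multigraph \<Rightarrow> 'e set \<Rightarrow> bool" where
  "eulerian G A \<longleftrightarrow> (\<forall>v\<in>verts G. even (degree G A v))"

definition adjacency :: "('v, 'e) multigraph \<Rightarrow> 'e set \<Rightarrow> 'v rel" where
  "adjacency G A = {(u, v). \<exists>e\<in>A. ends G e = Upair u v}"

definition connectedness :: "('v, 'e) multigraph \<Rightarrow> 'e set \<Rightarrow> 'v rel" where
  "connectedness G A = {(u, v). u \<in> verts G \<and> v \<in> verts G \<and> (u, v) \<in> (adjacency G A)\<^sup>*}"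

definition num_components :: "('v, 'e) multigraph \<Rightarrow> 'e set \<Rightarrow> nat" where
  "num_components G A = card (verts G // connectedness G A)"

text \<open>
  For a finite multigraph and \<open>A \<subseteq> edges G\<close> none of the natural-number subtractions below
  truncates: \<open>num_components G A \<le> card (verts G)\<close>, \<open>rank_of G A \<le> rank_of G (edges G)\<close> and
  \<open>rank_of G A \<le> card A\<close>.
\<close>

definition rank_of :: "('v, 'e) multigraph \<Rightarrow> 'e set \<Rightarrow> nat" where
  "rank_of G A = card (verts G) - num_components G A"

definition graph_rank :: "('v, 'e) multigraph \<Rightarrow> nat" where
  "graph_rank G = rank_of G (edges G)"

definition nullity :: "('v, 'e) multigraph \<Rightarrow> nat" where
  "nullity G = card (edges G) - graph_rank G"

definition tutte :: "('v, 'e) multigraph \<Rightarrow> real \<Rightarrow> real \<Rightarrow> real" where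
  "tutte G x y =
     (\<Sum>A\<in>Pow (edges G).
        (x - 1) ^ (rank_of G (edges G) - rank_of G A) * (y - 1) ^ (card A - rank_of G A))"

definition bias :: "'a measure \<Rightarrow> ('a \<Rightarrow> bool) \<Rightarrow> real" where
  "bias M P = \<P>(\<omega> in M. P \<omega>) - \<P>(\<omega> in M. \<not> P \<omega>)"

definition cond_bias :: "'a measure \<Rightarrow> ('a \<Rightarrow> bool) \<Rightarrow> ('a \<Rightarrow> bool) \<Rightarrow> real" where
  "cond_bias M P Q = \<P>(\<omega> in M. P \<omega> \<bar> Q \<omega>) - \<P>(\<omega> in M. \<not> P \<omega> \<bar> Q \<omega>)"

definition random_edge_set :: "('v, 'e) multigraph \<Rightarrow> 'e set pmf" where
  "random_edge_set G = pmf_of_set (Pow (edges G))"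

text \<open>The joint law of three independent uniformly random edge sets.\<close>

definition random_triple :: "('v, 'e) multigraph \<Rightarrow> ('e set \<times> 'e set \<times> 'e set) pmf" where
  "random_triple G =
     pair_pmf (random_edge_set G) (pair_pmf (random_edge_set G) (random_edge_set G))"

definition size_cong :: "nat \<Rightarrow> 'e set \<times> 'e set \<times> 'e set \<Rightarrow> bool" where
  "size_cong i = (\<lambda>(A, B, C). [card A + card B + card C = i] (mod 3))"

definition eulerian_differences ::
    "('v, 'e) multigraph \<Rightarrow> 'e set \<times> 'e set \<times> 'e set \<Rightarrow> bool" where
  "eulerian_differences G =
     (\<lambda>(A, B, C). eulerian G (sym_diff A B) \<and> eulerian G (sym_diff B C))"

end

theory Submission
  imports Defs
begin

text \<open>
  With \<open>\<omega>\<close> a primitive cube root of unity, both claims follow once the sum of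
  \<open>\<omega> ^ (|A| + |B| + |C|)\<close> over the triples in question is computed and found to be real: its
  value is then the number of triples of total size \<open>0\<close> minus the number of those of total size
  \<open>1\<close> modulo \<open>3\<close>. Over all triples it is \<open>(1 + \<omega>) ^ (3 |E|) = (-1) ^ |E|\<close>. Over \<open>\<Delta>\<close>, put
  \<open>A = B \<triangle> X\<close> and \<open>C = B \<triangle> Y\<close> with \<open>X\<close>, \<open>Y\<close> eulerian; summing over \<open>B\<close> edge by edge gives \<open>2\<close> for
  an edge outside \<open>X \<union> Y\<close> and \<open>-1\<close> for one inside. Since a set \<open>A\<close> of edges has
  \<open>2 ^ (|A| - r(A))\<close> eulerian subsets, expanding the resulting product yields the Tutte polynomial.
\<close>

section \<open>Sums over subsets as products, and unions of equivalence classes\<close>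

text \<open>Expanding the product chooses \<open>f e\<close> or \<open>g e\<close> for each
  \<open>e\<close>, and \<open>B\<close> records where \<open>f\<close> is chosen. Keeping one
  product over all of \<open>E\<close> lets several such weights be multiplied edge by edge.\<close>

lemma sum_Pow_prod_if:
  fixes f g :: "'a \<Rightarrow> 'b::comm_semiring_1"
  assumes "finite E"
  shows "(\<Sum>B\<in>Pow E. \<Prod>e\<in>E. if e \<in> B then f e else g e) = (\<Prod>e\<in>E. f e + g e)"
  unfolding prod_add[OF assms]
proof (rule sum.cong)
  fix B assume "B \<in> Pow E"
  then have "E \<inter> {e. e \<in> B} = B" "E \<inter> - {e. e \<in> B} = E - B" by auto
  then show "(\<Prod>e\<in>E. if e \<in> B then f e else g e) = prod f B * prod g (E - B)"
    using assms by (simp only: prod.If_cases)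
qed simp

lemma prod_1_add:
  fixes f :: "'a \<Rightarrow> 'b::comm_semiring_1"
  assumes "finite A"
  shows "(\<Prod>x\<in>A. 1 + f x) = (\<Sum>X\<in>Pow A. \<Prod>x\<in>X. f x)"
  using prod_add[OF assms, of f "\<lambda>_. 1"] by (simp add: add.commute)

lemma power_card_eq_prod_if:
  fixes x :: "'b::comm_monoid_mult"
  assumes "finite E" "B \<subseteq> E"
  shows "x ^ card B = (\<Prod>e\<in>E. if e \<in> B then x else 1)"
  using assms by (simp add: prod.inter_restrict[symmetric] Int_absorb1)

text \<open>A saturated set is the union of the classes it contains, and disjointness of classes
  makes that family of classes unique. Hence these sets correspond to the subsets of
  \<open>V // R\<close>.\<close>

lemma card_saturated_subsets:
  assumes R: "equiv V R" and "finite V"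
  shows "card {U \<in> Pow V. \<forall>(u, v)\<in>R. u \<in> U \<longleftrightarrow> v \<in> U} = 2 ^ card (V // R)"
proof -
  have "bij_betw Union (Pow (V // R)) {U \<in> Pow V. \<forall>(u, v)\<in>R. u \<in> U \<longleftrightarrow> v \<in> U}"
  proof (rule bij_betw_byWitness[where f' = "\<lambda>U. {c \<in> V // R. c \<subseteq> U}"])
    show "\<forall>P\<in>Pow (V // R). {c \<in> V // R. c \<subseteq> \<Union> P} = P"
    proof (intro ballI equalityI subsetI)
      fix P c assume P: "P \<in> Pow (V // R)" and "c \<in> {c \<in> V // R. c \<subseteq> \<Union> P}"
      then have c: "c \<in> V // R" "c \<subseteq> \<Union> P" by auto
      obtain x where "x \<in> c" using in_quotient_imp_non_empty[OF R c(1)] by auto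
      with c obtain d where "d \<in> P" "x \<in> d" by auto
      with P \<open>x \<in> c\<close> c have "c = d" using quotient_disj[OF R] by blast
      with \<open>d \<in> P\<close> show "c \<in> P" by simp
    qed auto
    show "\<forall>U\<in>{U \<in> Pow V. \<forall>(u, v)\<in>R. u \<in> U \<longleftrightarrow> v \<in> U}. \<Union> {c \<in> V // R. c \<subseteq> U} = U"
    proof (intro ballI equalityI subsetI)
      fix U u assume U: "U \<in> {U \<in> Pow V. \<forall>(u, v)\<in>R. u \<in> U \<longleftrightarrow> v \<in> U}" and "u \<in> U"
      then have "u \<in> R `` {u}" "R `` {u} \<in> V // R" "R `` {u} \<subseteq> U"
        using equiv_class_self[OF R] by (auto intro: quotientI)
      then show "u \<in> \<Union> {c \<in> V // R. c \<subseteq> U}" by blast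
    qed auto
    show "\<Union> ` Pow (V // R) \<subseteq> {U \<in> Pow V. \<forall>(u, v)\<in>R. u \<in> U \<longleftrightarrow> v \<in> U}"
    proof (clarsimp, intro conjI)
      fix P assume P: "P \<subseteq> V // R"
      then show "\<Union> P \<subseteq> V" using Union_quotient[OF R] by blast
      have "v \<in> c" if "(u, v) \<in> R" "u \<in> c" "c \<in> P" for u v c
        using that P in_quotient_imp_closed[OF R] by blast
      moreover have "(v, u) \<in> R" if "(u, v) \<in> R" for u v
        using R that by (auto simp: equiv_def dest: symD)
      ultimately show "\<forall>(u, v)\<in>R. (\<exists>c\<in>P. u \<in> c) = (\<exists>c\<in>P. v \<in> c)" by blast
    qed
    show "(\<lambda>U. {c \<in> V // R. c \<subseteq> U}) ` {U \<in> Pow V. \<forall>(u, v)\<in>R. u \<in> U \<longleftrightarrow> v \<in> U}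
        \<subseteq> Pow (V // R)" by auto
  qed
  then show ?thesis
    using finite_quotient[OF \<open>finite V\<close>, of R] R by (simp add: bij_betw_same_card[symmetric] card_Pow equiv_type)
qed

section \<open>Uniform distributions and bias\<close>

lemma pair_pmf_of_set:
  assumes "finite A" "A \<noteq> {}" "finite B" "B \<noteq> {}"
  shows "pair_pmf (pmf_of_set A) (pmf_of_set B) = pmf_of_set (A \<times> B)"
proof (rule pmf_eqI)
  fix p :: "'a \<times> 'b"
  show "pmf (pair_pmf (pmf_of_set A) (pmf_of_set B)) p = pmf (pmf_of_set (A \<times> B)) p"
    using assms by (cases p) (auto simp: pmf_pair indicator_def card_cartesian_product)
qed

text \<open>Conditioning a uniform choice on \<open>Q\<close> makes it uniform on \<open>T\<close>,
  and an event of probability \<open>p\<close> has bias \<open>2 * p - 1\<close>.\<close>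

lemma cond_bias_pmf_of_set:
  fixes Q :: "'a \<Rightarrow> bool"
  assumes "finite S" "T = {x \<in> S. Q x}" "T \<noteq> {}"
  shows "cond_bias (measure_pmf (pmf_of_set S)) P Q
    = 2 * real (card {x \<in> T. P x}) / real (card T) - 1"
proof -
  have "S \<noteq> {}" "finite T" using assms by auto
  have "card T = card ({x \<in> T. P x} \<union> {x \<in> T. \<not> P x})" by (rule arg_cong[where f = card]) auto
  also have "\<dots> = card {x \<in> T. P x} + card {x \<in> T. \<not> P x}"
    using \<open>finite T\<close> by (intro card_Un_disjoint) auto
  finally have split: "real (card {x \<in> T. \<not> P x}) = real (card T) - real (card {x \<in> T. P x})" by simp
  have "\<P>(x in measure_pmf (pmf_of_set S). R x \<bar> Q x) = real (card {x \<in> T. R x}) / real (card T)" for R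
  proof -
    have "S \<inter> {x. R x \<and> Q x} = {x \<in> T. R x}" "S \<inter> {x. Q x} = T" using assms(2) by auto
    with \<open>S \<noteq> {}\<close> \<open>finite S\<close> show ?thesis
      by (simp add: cond_prob_def measure_pmf_of_set)
  qed
  then show ?thesis
    using \<open>finite T\<close> \<open>T \<noteq> {}\<close> by (simp add: cond_bias_def split field_simps)
qed

lemma bias_eq_cond_bias: "bias (measure_pmf p) P = cond_bias (measure_pmf p) P (\<lambda>_. True)"
  by (simp add: bias_def cond_bias_def cond_prob_def)

section \<open>Cube roots of unity and residues modulo 3\<close>

text \<open>This is \<open>exp (2 * pi * i / 3)\<close>, in coordinates so that its real and
  imaginary parts are at hand.\<close>

definition omega :: complex where
  "omega = Complex (-1/2) (sqrt 3 / 2)"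

lemma omega_squared: "omega ^ 2 = -1 - omega"
  by (simp add: omega_def power2_eq_square complex_eq_iff)

lemma omega_cubed: "omega ^ 3 = 1"
  by (simp add: omega_def power3_eq_cube complex_eq_iff)

lemma one_plus_omega_cubed: "(1 + omega) ^ 3 = -1"
proof -
  have "(1 + omega) ^ 3 = (- (omega ^ 2)) ^ 3" by (simp add: omega_squared add.commute)
  also have "\<dots> = - ((omega ^ 3) ^ 2)" by (simp add: power3_eq_cube power2_eq_square mult_ac)
  finally show ?thesis by (simp add: omega_cubed)
qed

lemma omega_power: "omega ^ n = (if n mod 3 = 0 then 1 else if n mod 3 = 1 then omega else -1 - omega)"
proof -
  have "omega ^ n = (omega ^ 3) ^ (n div 3) * omega ^ (n mod 3)"
    by (metis power_add power_mult mult_div_mod_eq)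
  moreover have "n mod 3 = 0 \<or> n mod 3 = 1 \<or> n mod 3 = 2" by auto
  ultimately show ?thesis by (auto simp: omega_cubed omega_squared)
qed

text \<open>With \<open>c i\<close> elements in residue class \<open>i\<close>, the sum is
  \<open>c 0 + c 1 * omega + c 2 * omega ^ 2\<close>. Its imaginary part is a nonzero multiple of
  \<open>c 1 - c 2\<close>, so a real value forces \<open>c 1 = c 2\<close>, and the real part
  becomes \<open>c 0 - c 1\<close>.\<close>

lemma residue_counts_of_omega_sum:
  fixes s :: "'a \<Rightarrow> nat"
  assumes "finite T" and sum: "(\<Sum>t\<in>T. omega ^ s t) = of_real z"
  shows "card {t \<in> T. s t mod 3 = 1} = card {t \<in> T. s t mod 3 = 2}"
    and "real (card {t \<in> T. s t mod 3 = 0}) - card {t \<in> T. s t mod 3 = 1} = z"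
proof -
  define c where "c i = real (card {t \<in> T. s t mod 3 = i})" for i
  have c: "(\<Sum>t\<in>T. of_bool (s t mod 3 = i)) = c i" for i
    using \<open>finite T\<close> by (simp add: c_def Int_def)
  have "Re (omega ^ n) = of_bool (n mod 3 = 0) - of_bool (n mod 3 = 1) / 2 - of_bool (n mod 3 = 2) / 2"
    and "Im (omega ^ n) = (of_bool (n mod 3 = 1) - of_bool (n mod 3 = 2)) * (sqrt 3 / 2)" for n
  proof -
    have "n mod 3 = 0 \<or> n mod 3 = 1 \<or> n mod 3 = 2" by auto
    then show "Re (omega ^ n) = of_bool (n mod 3 = 0) - of_bool (n mod 3 = 1) / 2 - of_bool (n mod 3 = 2) / 2"
      and "Im (omega ^ n) = (of_bool (n mod 3 = 1) - of_bool (n mod 3 = 2)) * (sqrt 3 / 2)"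
      by (auto simp: omega_power) (auto simp: omega_def)
  qed
  then have "Re (\<Sum>t\<in>T. omega ^ s t) = c 0 - c 1 / 2 - c 2 / 2"
    and "Im (\<Sum>t\<in>T. omega ^ s t) = (c 1 - c 2) * (sqrt 3 / 2)"
    by (simp_all only: Re_sum Im_sum sum_subtractf c flip: sum_divide_distrib sum_distrib_right)
  with sum have "c 1 = c 2" "c 0 - c 1 = z" by simp_all
  then show "card {t \<in> T. s t mod 3 = 1} = card {t \<in> T. s t mod 3 = 2}"
    and "real (card {t \<in> T. s t mod 3 = 0}) - card {t \<in> T. s t mod 3 = 1} = z"
    by (simp_all add: c_def)
qed

definition total_size :: "'e set \<times> 'e set \<times> 'e set \<Rightarrow> nat" where
  "total_size = (\<lambda>(A, B, C). card A + card B + card C)"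

text \<open>Each bias is an affine function of a residue count, the same one for all residues, so
  equalities and differences of biases reduce to those of the counts.\<close>

lemma cond_bias_size_cong:
  assumes "finite S" "T = {t \<in> S. Q t}" "T \<noteq> {}"
    and sum: "(\<Sum>t\<in>T. omega ^ total_size t) = of_real z"
  shows "cond_bias (pmf_of_set S) (size_cong 1) Q = cond_bias (pmf_of_set S) (size_cong 2) Q"
    and "cond_bias (pmf_of_set S) (size_cong 0) Q - cond_bias (pmf_of_set S) (size_cong 1) Q
         = 2 * z / real (card T)"
proof -
  have "finite T" using assms by simp
  have "size_cong i t \<longleftrightarrow> total_size t mod 3 = i mod 3" for i and t :: "'a set \<times> 'a set \<times> 'a set"
    by (cases t) (simp add: size_cong_def total_size_def cong_def)
  then have bias: "cond_bias (pmf_of_set S) (size_cong i) Q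
      = 2 * real (card {t \<in> T. total_size t mod 3 = i mod 3}) / real (card T) - 1" for i
    by (simp add: cond_bias_pmf_of_set[OF assms(1-3)])
  note counts = residue_counts_of_omega_sum[OF \<open>finite T\<close> sum]
  show "cond_bias (pmf_of_set S) (size_cong 1) Q = cond_bias (pmf_of_set S) (size_cong 2) Q"
    using counts(1) by (simp add: bias)
  show "cond_bias (pmf_of_set S) (size_cong 0) Q - cond_bias (pmf_of_set S) (size_cong 1) Q
      = 2 * z / real (card T)"
    unfolding counts(2)[symmetric] by (simp add: bias diff_divide_distrib right_diff_distrib)
qed

section \<open>Cuts, components and the number of eulerian subsets\<close>

lemma incidence_Upair:
  assumes "ends G e = Upair a b"
  shows "incidence G e v = of_bool (v = a) + of_bool (v = b)"
  using assms by (auto simp: incidence_def)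

text \<open>Each end of \<open>e\<close> lying in \<open>U\<close> contributes one sign. The two
  signs of a loop cancel, in accordance with a loop never crossing a cut.\<close>

lemma prod_sign_incidence:
  assumes "ends G e = Upair a b" "finite U"
  shows "(\<Prod>v\<in>U. (-1) ^ incidence G e v) = (if a \<in> U \<longleftrightarrow> b \<in> U then 1 else -1 :: int)"
proof -
  have "(\<Prod>v\<in>U. (-1) ^ incidence G e v)
      = (\<Prod>v\<in>U. if v = a then -1 else 1) * (\<Prod>v\<in>U. if v = b then -1 else (1::int))"
    unfolding prod.distrib[symmetric] by (rule prod.cong) (auto simp: incidence_Upair[OF assms(1)])
  then show ?thesis using assms(2) by (simp add: prod.delta)
qed

context finite_multigraph
begin

lemma equiv_connectedness: "equiv (verts G) (connectedness G A)"
proof (rule equivI)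
  have "sym (adjacency G A)"
  proof (rule symI)
    fix u v assume "(u, v) \<in> adjacency G A"
    then obtain e where "e \<in> A" "ends G e = Upair v u" by (auto simp: adjacency_def)
    then show "(v, u) \<in> adjacency G A" unfolding adjacency_def by blast
  qed
  then have "sym ((adjacency G A)\<^sup>*)" by (rule sym_rtrancl)
  then show "sym (connectedness G A)" by (auto simp: sym_def connectedness_def)
qed (auto simp: connectedness_def refl_on_def trans_def intro: rtrancl_trans)

definition uncut :: "'v set \<Rightarrow> 'e set \<Rightarrow> bool" where
  "uncut U A \<longleftrightarrow> (\<forall>(u, v)\<in>adjacency G A. u \<in> U \<longleftrightarrow> v \<in> U)"

text \<open>Membership in \<open>U\<close> propagates along paths, so the uncut sets are exactly the
  unions of components of \<open>(V, A)\<close>.\<close>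

lemma card_uncut:
  assumes "A \<subseteq> edges G"
  shows "card {U \<in> Pow (verts G). uncut U A} = 2 ^ num_components G A"
proof -
  have "uncut U A \<longleftrightarrow> (\<forall>(u, v)\<in>connectedness G A. u \<in> U \<longleftrightarrow> v \<in> U)" for U
  proof
    assume U: "uncut U A"
    have "(u, v) \<in> (adjacency G A)\<^sup>* \<Longrightarrow> u \<in> U \<longleftrightarrow> v \<in> U" for u v
      by (induction rule: rtrancl_induct) (use U in \<open>auto simp: uncut_def\<close>)
    then show "\<forall>(u, v)\<in>connectedness G A. u \<in> U \<longleftrightarrow> v \<in> U" by (auto simp: connectedness_def)
  next
    assume U: "\<forall>(u, v)\<in>connectedness G A. u \<in> U \<longleftrightarrow> v \<in> U"
    have "adjacency G A \<subseteq> connectedness G A"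
      using assms ends_in_verts by (fastforce simp: adjacency_def connectedness_def)
    with U show "uncut U A" by (auto simp: uncut_def)
  qed
  then show ?thesis
    using card_saturated_subsets[OF equiv_connectedness finite_verts] by (simp add: num_components_def)
qed

definition eulerian_subsets :: "'e set \<Rightarrow> 'e set set" where
  "eulerian_subsets A = {X \<in> Pow A. eulerian G X}"

lemma finite_edge_subset: "A \<subseteq> edges G \<Longrightarrow> finite A"
  using finite_edges by (rule rev_finite_subset)

text \<open>
  Parity of all degrees is detected by the characters \<open>X \<mapsto> (-1) ^ (\<Sum>v\<in>U. deg X v)\<close>, \<open>U \<subseteq> V\<close>;
  summing over \<open>X\<close> first, only the unions \<open>U\<close> of components of \<open>(V, A)\<close> contribute.
\<close>

lemma card_eulerian_subsets_mult:
  assumes "A \<subseteq> edges G"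
  shows "card (eulerian_subsets A) * 2 ^ card (verts G) = 2 ^ (card A + num_components G A)"
proof -
  note fin = finite_edge_subset[OF assms] finite_verts
  have "int (card (eulerian_subsets A) * 2 ^ card (verts G))
      = (\<Sum>X\<in>Pow A. if eulerian G X then 2 ^ card (verts G) else 0)"
    using fin by (simp add: eulerian_subsets_def flip: sum.inter_filter)
  \<comment> \<open>A factor is 2 at a vertex of even degree and 0 at one of odd degree.\<close>
  also have "\<dots> = (\<Sum>X\<in>Pow A. \<Prod>v\<in>verts G. 1 + (-1) ^ degree G X v)"
  proof (rule sum.cong)
    fix X
    show "(if eulerian G X then 2 ^ card (verts G) else 0)
        = (\<Prod>v\<in>verts G. 1 + (-1) ^ degree G X v :: int)"
    proof (cases "eulerian G X")
      case True
      then show ?thesis by (simp add: eulerian_def)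
    next
      case False
      then obtain v where "v \<in> verts G" "odd (degree G X v)" by (auto simp: eulerian_def)
      then have "(\<Prod>v\<in>verts G. 1 + (-1) ^ degree G X v :: int) = 0"
        using fin by (intro prod_zero bexI[of _ v]) auto
      with False show ?thesis by simp
    qed
  qed simp
  also have "\<dots> = (\<Sum>X\<in>Pow A. \<Sum>U\<in>Pow (verts G). \<Prod>e\<in>X. \<Prod>v\<in>U. (-1) ^ incidence G e v)"
  proof (rule sum.cong)
    fix X
    have "(\<Prod>v\<in>verts G. 1 + (-1) ^ degree G X v :: int)
        = (\<Sum>U\<in>Pow (verts G). \<Prod>v\<in>U. (-1) ^ degree G X v)"
      by (rule prod_1_add[OF finite_verts])
    also have "\<dots> = (\<Sum>U\<in>Pow (verts G). \<Prod>e\<in>X. \<Prod>v\<in>U. (-1) ^ incidence G e v)"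
      unfolding degree_def power_sum by (subst prod.swap) simp
    finally show "(\<Prod>v\<in>verts G. 1 + (-1) ^ degree G X v :: int)
        = (\<Sum>U\<in>Pow (verts G). \<Prod>e\<in>X. \<Prod>v\<in>U. (-1) ^ incidence G e v)" .
  qed simp
  also have "\<dots> = (\<Sum>U\<in>Pow (verts G). \<Prod>e\<in>A. 1 + (\<Prod>v\<in>U. (-1) ^ incidence G e v))"
    by (subst sum.swap) (simp only: prod_1_add[OF fin(1)])
  \<comment> \<open>An edge crossing the cut of \<open>U\<close> gives the factor
    \<open>1 - 1\<close>, any other edge \<open>1 + 1\<close>.\<close>
  also have "\<dots> = (\<Sum>U\<in>Pow (verts G). if uncut U A then 2 ^ card A else 0)"
  proof (rule sum.cong)
    fix U assume "U \<in> Pow (verts G)"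
    then have U: "finite U" using finite_verts finite_subset by auto
    show "(\<Prod>e\<in>A. 1 + (\<Prod>v\<in>U. (-1) ^ incidence G e v)) = (if uncut U A then 2 ^ card A else 0 :: int)"
    proof (cases "uncut U A")
      case True
      have "(\<Prod>v\<in>U. (-1) ^ incidence G e v) = (1 :: int)" if "e \<in> A" for e
      proof (cases "ends G e")
        case (Upair a b)
        with True that have "a \<in> U \<longleftrightarrow> b \<in> U" by (auto simp: uncut_def adjacency_def)
        with prod_sign_incidence[OF Upair U] show ?thesis by simp
      qed
      with True show ?thesis by simp
    next
      case False
      then obtain e a b where e: "e \<in> A" "ends G e = Upair a b" "(a \<in> U) \<noteq> (b \<in> U)"
        by (auto simp: uncut_def adjacency_def)
      then have "(\<Prod>e\<in>A. 1 + (\<Prod>v\<in>U. (-1) ^ incidence G e v)) = (0 :: int)"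
        using fin prod_sign_incidence[OF e(2) U] by (intro prod_zero bexI[of _ e]) auto
      with False show ?thesis by simp
    qed
  qed simp
  also have "\<dots> = int (2 ^ (card A + num_components G A))"
    using finite_verts card_uncut[OF assms]
    by (simp add: power_add flip: sum.inter_filter)
  finally show ?thesis by (simp only: of_nat_eq_iff)
qed

section \<open>Rank inequalities\<close>

lemma num_components_le: "num_components G A \<le> card (verts G)"
  by (simp add: num_components_def quotient_def UNION_singleton_eq_range card_image_le finite_verts)

text \<open>A set uncut by \<open>B\<close> is uncut by \<open>A\<close>; since the numbers of uncut
  sets are powers of 2, comparing them compares the exponents.\<close>

lemma num_components_antimono:
  assumes "A \<subseteq> B" "B \<subseteq> edges G"
  shows "num_components G B \<le> num_components G A"
proof -
  have "uncut U A" if "uncut U B" for U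
    using that assms(1) by (auto simp: uncut_def adjacency_def)
  then have "{U \<in> Pow (verts G). uncut U B} \<subseteq> {U \<in> Pow (verts G). uncut U A}" by auto
  then have "card {U \<in> Pow (verts G). uncut U B} \<le> card {U \<in> Pow (verts G). uncut U A}"
    using finite_verts by (intro card_mono) auto
  then show ?thesis
    unfolding card_uncut[OF assms(2)] card_uncut[OF order_trans[OF assms]] by simp
qed

text \<open>The empty set is eulerian, so the count is at least 1 and the product formula yields
  \<open>|V| \<le> |A| + k(A)\<close>. This makes the subtraction in the exponent exact, and
  \<open>2 ^ |V|\<close> cancels.\<close>

lemma card_eulerian_subsets:
  assumes "A \<subseteq> edges G"
  shows "rank_of G A \<le> card A" "card (eulerian_subsets A) = 2 ^ (card A - rank_of G A)"
proof -
  have fin: "finite (eulerian_subsets A)"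
    using finite_edge_subset[OF assms] by (simp add: eulerian_subsets_def)
  have "{} \<in> eulerian_subsets A" by (simp add: eulerian_subsets_def eulerian_def degree_def)
  with fin have "card (eulerian_subsets A) \<ge> 1" by (auto simp: Suc_le_eq card_gt_0_iff)
  then have "(2::nat) ^ card (verts G) \<le> card (eulerian_subsets A) * 2 ^ card (verts G)" by simp
  then have "card (verts G) \<le> card A + num_components G A"
    unfolding card_eulerian_subsets_mult[OF assms] by simp
  then show r: "rank_of G A \<le> card A" by (simp add: rank_of_def)
  then have "card A + num_components G A = (card A - rank_of G A) + card (verts G)"
    using num_components_le[of A] by (simp add: rank_of_def)
  then show "card (eulerian_subsets A) = 2 ^ (card A - rank_of G A)"
    using card_eulerian_subsets_mult[OF assms] by (simp add: power_add)
qed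

lemma rank_of_mono: "A \<subseteq> B \<Longrightarrow> B \<subseteq> edges G \<Longrightarrow> rank_of G A \<le> rank_of G B"
  unfolding rank_of_def by (intro diff_le_mono2 num_components_antimono)

section \<open>The flow sum as a Tutte evaluation\<close>

text \<open>
  The pairs \<open>(X, Y)\<close> are the \<open>\<int>\<^sub>2 \<times> \<int>\<^sub>2\<close>-flows, weighted by \<open>-2\<close> for each edge on which the flow
  vanishes; writing \<open>-2 = 1 + (-3)\<close> picks a set of edges on which it is required to vanish.
\<close>

lemma flow_sum_eq_tutte:
  "(\<Sum>X\<in>eulerian_subsets (edges G). \<Sum>Y\<in>eulerian_subsets (edges G).
      \<Prod>e\<in>edges G. if e \<in> X \<or> e \<in> Y then 1 else -2 :: real)
    = (-3) ^ nullity G * tutte G (-2) (-1/3)"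
proof -
  let ?E = "edges G"
  have fin: "finite (eulerian_subsets ?E)"
    using finite_edges by (simp add: eulerian_subsets_def)
  have "(\<Prod>e\<in>?E. if e \<in> X \<or> e \<in> Y then 1 else -2 :: real)
      = (\<Sum>A\<in>Pow ?E. of_bool (X \<subseteq> A) * of_bool (Y \<subseteq> A) * (-3) ^ (card ?E - card A))"
    if "X \<subseteq> ?E" "Y \<subseteq> ?E" for X Y
  proof -
    have "(\<Prod>e\<in>?E. if e \<in> X \<or> e \<in> Y then 1 else -2 :: real)
        = (\<Prod>e\<in>?E. 1 + (if e \<in> X \<or> e \<in> Y then 0 else -3))"
      by (rule prod.cong) auto
    \<comment> \<open>\<open>A\<close> collects the edges where the summand 1 is chosen. The flow
      must vanish off \<open>A\<close>, so a term survives only if \<open>X\<close> and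
      \<open>Y\<close> are both contained in \<open>A\<close>.\<close>
    also have "\<dots> = (\<Sum>A\<in>Pow ?E. (\<Prod>e\<in>?E - A. if e \<in> X \<or> e \<in> Y then 0 else -3))"
      by (simp add: prod_add[OF finite_edges])
    also have "\<dots> = (\<Sum>A\<in>Pow ?E. of_bool (X \<subseteq> A) * of_bool (Y \<subseteq> A) * (-3) ^ (card ?E - card A))"
    proof (rule sum.cong)
      fix A assume A: "A \<in> Pow ?E"
      show "(\<Prod>e\<in>?E - A. if e \<in> X \<or> e \<in> Y then 0 else -3 :: real)
          = (of_bool (X \<subseteq> A) * of_bool (Y \<subseteq> A) * (-3) ^ (card ?E - card A))"
      proof (cases "X \<subseteq> A \<and> Y \<subseteq> A")
        case True
        then have "(\<Prod>e\<in>?E - A. if e \<in> X \<or> e \<in> Y then 0 else -3 :: real) = (\<Prod>e\<in>?E - A. -3)"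
          by (intro prod.cong) auto
        with True A show ?thesis by (simp add: card_Diff_subset finite_edge_subset)
      next
        case False
        with that obtain e where "e \<in> ?E - A" "e \<in> X \<or> e \<in> Y" by blast
        then have "(\<Prod>e\<in>?E - A. if e \<in> X \<or> e \<in> Y then 0 else -3 :: real) = 0"
          using finite_edges by (intro prod_zero bexI[of _ e]) auto
        with False show ?thesis by auto
      qed
    qed simp
    finally show ?thesis .
  qed
  note expand = this
  have "(\<Sum>X\<in>eulerian_subsets ?E. \<Sum>Y\<in>eulerian_subsets ?E.
        \<Prod>e\<in>?E. if e \<in> X \<or> e \<in> Y then 1 else -2 :: real)
      = (\<Sum>X\<in>eulerian_subsets ?E. \<Sum>Y\<in>eulerian_subsets ?E. \<Sum>A\<in>Pow ?E.
        of_bool (X \<subseteq> A) * of_bool (Y \<subseteq> A) * (-3) ^ (card ?E - card A))"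
    by (intro sum.cong expand refl) (auto simp: eulerian_subsets_def)
  also have "\<dots> = (\<Sum>A\<in>Pow ?E. \<Sum>X\<in>eulerian_subsets ?E. \<Sum>Y\<in>eulerian_subsets ?E.
        of_bool (X \<subseteq> A) * of_bool (Y \<subseteq> A) * (-3) ^ (card ?E - card A))"
    by (subst (2) sum.swap, subst sum.swap) simp
  \<comment> \<open>For fixed \<open>A\<close> the conditions on \<open>X\<close> and
    \<open>Y\<close> separate, so the double sum is a square.\<close>
  also have "\<dots> = (\<Sum>A\<in>Pow ?E. (\<Sum>X\<in>eulerian_subsets ?E. of_bool (X \<subseteq> A)) ^ 2
        * (-3) ^ (card ?E - card A))"
    by (simp add: power2_eq_square flip: sum_distrib_left sum_distrib_right)
  also have "\<dots> = (\<Sum>A\<in>Pow ?E. (-3) ^ nullity G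
        * ((-3) ^ (rank_of G ?E - rank_of G A) * (-4/3) ^ (card A - rank_of G A)))"
  proof (rule sum.cong)
    fix A assume "A \<in> Pow ?E"
    then have A: "A \<subseteq> ?E" by simp
    then have "eulerian_subsets ?E \<inter> {X. X \<subseteq> A} = eulerian_subsets A"
      by (auto simp: eulerian_subsets_def)
    then have "(\<Sum>X\<in>eulerian_subsets ?E. of_bool (X \<subseteq> A)) = real (card (eulerian_subsets A))"
      using fin by (simp add: sum_of_bool_eq)
    then have sq: "(\<Sum>X\<in>eulerian_subsets ?E. of_bool (X \<subseteq> A)) ^ 2 = (4::real) ^ (card A - rank_of G A)"
      using card_eulerian_subsets(2)[OF A] by (simp add: power2_eq_square flip: power_mult_distrib)
    define c where "c = card A - rank_of G A"
    \<comment> \<open>Here \<open>x - 1 = -3\<close> and \<open>y - 1 = -4/3\<close>, and the square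
      is \<open>4 ^ c\<close> with \<open>4 = (-3) * (-4/3)\<close>. The identity collects the
      exponents of \<open>-3\<close>.\<close>
    have "nullity G + (rank_of G ?E - rank_of G A) = (card ?E - card A) + c"
      using card_eulerian_subsets(1)[OF A] card_eulerian_subsets(1)[of ?E] rank_of_mono[OF A]
        card_mono[OF finite_edges A]
      by (simp add: nullity_def graph_rank_def c_def)
    then have "(-3::real) ^ nullity G * ((-3) ^ (rank_of G ?E - rank_of G A) * (-4/3) ^ c)
        = (-3) ^ (card ?E - card A) * ((-3) ^ c * (-4/3) ^ c)"
      by (metis (no_types, lifting) mult.assoc power_add)
    also have "(-3::real) ^ c * (-4/3) ^ c = 4 ^ c"
      by (simp flip: power_mult_distrib)
    finally show "(\<Sum>X\<in>eulerian_subsets ?E. of_bool (X \<subseteq> A)) ^ 2 * (-3) ^ (card ?E - card A)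
        = (-3::real) ^ nullity G
          * ((-3) ^ (rank_of G ?E - rank_of G A) * (-4/3) ^ (card A - rank_of G A))"
      unfolding sq c_def by simp
  qed simp
  also have "\<dots> = (-3) ^ nullity G * tutte G (-2) (-1/3)"
    by (simp add: tutte_def sum_distrib_left)
  finally show ?thesis .
qed

section \<open>Sums of powers of \<open>omega\<close> over triples\<close>

lemma random_triple_eq:
  "random_triple G = pmf_of_set (Pow (edges G) \<times> Pow (edges G) \<times> Pow (edges G))"
  using finite_edges
  by (simp add: random_triple_def random_edge_set_def pair_pmf_of_set Pow_not_empty)

text \<open>The sum factors into three copies of \<open>(1 + omega) ^ |E|\<close>, and
  \<open>(1 + omega) ^ 3 = -1\<close>.\<close>

lemma sum_omega_triples:
  "(\<Sum>t\<in>Pow (edges G) \<times> Pow (edges G) \<times> Pow (edges G). omega ^ total_size t)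
    = of_real ((-1) ^ card (edges G))"
proof -
  have "(\<Sum>A\<in>Pow (edges G). omega ^ card A) = (1 + omega) ^ card (edges G)"
    using prod_1_add[OF finite_edges, of "\<lambda>_. omega"] by simp
  moreover have "(\<Sum>t\<in>Pow (edges G) \<times> Pow (edges G) \<times> Pow (edges G). omega ^ total_size t)
      = (\<Sum>A\<in>Pow (edges G). omega ^ card A) ^ 3"
    by (simp add: total_size_def power_add power3_eq_cube mult.assoc sum.cartesian_product'
        flip: sum_distrib_left sum_distrib_right)
  ultimately show ?thesis
    by (metis (no_types, lifting) one_plus_omega_cubed of_real_1 of_real_minus of_real_power
        mult.commute power_mult)
qed

text \<open>Symmetric difference with \<open>B\<close> is an involution, so a triple in the event is
  determined by its middle set and two arbitrary eulerian sets.\<close>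

lemma bij_betw_eulerian_triples:
  "bij_betw (\<lambda>(X, Y, B). (sym_diff B X, B, sym_diff B Y))
     (eulerian_subsets (edges G) \<times> eulerian_subsets (edges G) \<times> Pow (edges G))
     {t \<in> Pow (edges G) \<times> Pow (edges G) \<times> Pow (edges G). eulerian_differences G t}"
proof (rule bij_betw_byWitness[where f' = "\<lambda>(A, B, C). (sym_diff A B, sym_diff B C, B)"])
  have cancel: "sym_diff (sym_diff B X) B = X" "sym_diff B (sym_diff B X) = X"
    "sym_diff B (sym_diff X B) = X" for B X :: "'e set"
    by auto
  show "\<forall>p\<in>eulerian_subsets (edges G) \<times> eulerian_subsets (edges G) \<times> Pow (edges G).
      (\<lambda>(A, B, C). (sym_diff A B, sym_diff B C, B)) ((\<lambda>(X, Y, B). (sym_diff B X, B, sym_diff B Y)) p) = p"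
    by (clarsimp simp: cancel)
  show "\<forall>t\<in>{t \<in> Pow (edges G) \<times> Pow (edges G) \<times> Pow (edges G). eulerian_differences G t}.
      (\<lambda>(X, Y, B). (sym_diff B X, B, sym_diff B Y)) ((\<lambda>(A, B, C). (sym_diff A B, sym_diff B C, B)) t) = t"
    by (clarsimp simp: cancel)
  show "(\<lambda>(X, Y, B). (sym_diff B X, B, sym_diff B Y)) `
      (eulerian_subsets (edges G) \<times> eulerian_subsets (edges G) \<times> Pow (edges G))
      \<subseteq> {t \<in> Pow (edges G) \<times> Pow (edges G) \<times> Pow (edges G). eulerian_differences G t}"
    by (clarsimp simp: eulerian_differences_def eulerian_subsets_def cancel) blast
  show "(\<lambda>(A, B, C). (sym_diff A B, sym_diff B C, B)) `
      {t \<in> Pow (edges G) \<times> Pow (edges G) \<times> Pow (edges G). eulerian_differences G t}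
      \<subseteq> eulerian_subsets (edges G) \<times> eulerian_subsets (edges G) \<times> Pow (edges G)"
    by (clarsimp simp: eulerian_differences_def eulerian_subsets_def) blast
qed

lemma sum_omega_eulerian_triples:
  "(\<Sum>t | t \<in> Pow (edges G) \<times> Pow (edges G) \<times> Pow (edges G) \<and> eulerian_differences G t.
      omega ^ total_size t)
    = of_real (\<Sum>X\<in>eulerian_subsets (edges G). \<Sum>Y\<in>eulerian_subsets (edges G).
        \<Prod>e\<in>edges G. if e \<in> X \<or> e \<in> Y then -1 else 2)"
proof -
  let ?E = "edges G" and ?C = "eulerian_subsets (edges G)"
  have prod: "(\<Sum>B\<in>Pow ?E. omega ^ total_size (sym_diff B X, B, sym_diff B Y))
      = (\<Prod>e\<in>?E. if e \<in> X \<or> e \<in> Y then -1 else 2)"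
    if "X \<subseteq> ?E" "Y \<subseteq> ?E" for X Y
  proof -
    let ?f = "\<lambda>e. (if e \<in> X then 1 else omega) * omega * (if e \<in> Y then 1 else omega)"
    let ?g = "\<lambda>e. (if e \<in> X then omega else 1) * (if e \<in> Y then omega else 1)"
    have summand: "omega ^ total_size (sym_diff B X, B, sym_diff B Y)
        = (\<Prod>e\<in>?E. if e \<in> B then ?f e else ?g e)" if "B \<in> Pow ?E" for B
    proof -
      have "omega ^ total_size (sym_diff B X, B, sym_diff B Y)
          = (\<Prod>e\<in>?E. if e \<in> sym_diff B X then omega else 1) * (\<Prod>e\<in>?E. if e \<in> B then omega else 1)
            * (\<Prod>e\<in>?E. if e \<in> sym_diff B Y then omega else 1)"
        using that \<open>X \<subseteq> ?E\<close> \<open>Y \<subseteq> ?E\<close>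
        by (subst (1 2 3) power_card_eq_prod_if[OF finite_edges, symmetric])
          (auto simp: total_size_def power_add)
      then show ?thesis by (simp only: flip: prod.distrib) (auto intro!: prod.cong)
    qed
    have "(\<Sum>B\<in>Pow ?E. omega ^ total_size (sym_diff B X, B, sym_diff B Y))
        = (\<Sum>B\<in>Pow ?E. \<Prod>e\<in>?E. if e \<in> B then ?f e else ?g e)"
      by (intro sum.cong refl summand)
    also have "\<dots> = (\<Prod>e\<in>?E. ?f e + ?g e)"
      by (rule sum_Pow_prod_if[OF finite_edges])
    \<comment> \<open>An edge in neither \<open>X\<close> nor \<open>Y\<close> gives
      \<open>omega ^ 3 + 1 = 2\<close>. In one or both of them it gives \<open>omega\<close> and
      \<open>omega ^ 2\<close> in some order, with sum \<open>-1\<close>.\<close>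
    also have "\<dots> = (\<Prod>e\<in>?E. if e \<in> X \<or> e \<in> Y then -1 else 2)"
      using omega_squared omega_cubed
      by (intro prod.cong) (auto simp: power2_eq_square power3_eq_cube)
    finally show ?thesis .
  qed
  have "(\<Sum>t | t \<in> Pow ?E \<times> Pow ?E \<times> Pow ?E \<and> eulerian_differences G t. omega ^ total_size t)
      = (\<Sum>(X, Y, B)\<in>?C \<times> ?C \<times> Pow ?E. omega ^ total_size (sym_diff B X, B, sym_diff B Y))"
    by (subst sum.reindex_bij_betw[OF bij_betw_eulerian_triples, symmetric])
      (simp add: case_prod_unfold)
  also have "\<dots> = (\<Sum>X\<in>?C. \<Sum>Y\<in>?C. \<Sum>B\<in>Pow ?E. omega ^ total_size (sym_diff B X, B, sym_diff B Y))"
    by (simp add: sum.cartesian_product case_prod_unfold)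
  also have "\<dots> = (\<Sum>X\<in>?C. \<Sum>Y\<in>?C. \<Prod>e\<in>?E. if e \<in> X \<or> e \<in> Y then -1 else 2)"
    using prod by (intro sum.cong) (auto simp: eulerian_subsets_def)
  also have "\<dots> = of_real (\<Sum>X\<in>?C. \<Sum>Y\<in>?C. \<Prod>e\<in>?E. if e \<in> X \<or> e \<in> Y then -1 else 2)"
    by (simp add: if_distrib cong: if_cong)
  finally show ?thesis .
qed

end

theorem theorem2p16:
  fixes G :: "('v, 'e) multigraph"
  assumes "finite_multigraph G"
  shows "cond_bias (random_triple G) (size_cong 1) (eulerian_differences G) =
         cond_bias (random_triple G) (size_cong 2) (eulerian_differences G) \<and>
         (cond_bias (random_triple G) (size_cong 0) (eulerian_differences G) -
          cond_bias (random_triple G) (size_cong 1) (eulerian_differences G)) /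
         (bias (random_triple G) (size_cong 0) - bias (random_triple G) (size_cong 1)) =
         4 ^ graph_rank G * (-3) ^ nullity G * tutte G (-2) (-1/3)"
proof -
  interpret finite_multigraph G by fact
  let ?E = "edges G" and ?C = "eulerian_subsets (edges G)"
  define m where "m = card ?E"
  define S where "S = Pow ?E \<times> Pow ?E \<times> Pow ?E"
  define T where "T = {t \<in> S. eulerian_differences G t}"
  define z where "z = (\<Sum>X\<in>?C. \<Sum>Y\<in>?C. \<Prod>e\<in>?E. if e \<in> X \<or> e \<in> Y then -1 else 2 :: real)"
  have m: "m = graph_rank G + nullity G"
    using card_eulerian_subsets(1)[of ?E] by (simp add: m_def nullity_def graph_rank_def)
  have S: "finite S" "S \<noteq> {}" "card S = 2 ^ m * (2 ^ m * 2 ^ m)"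
    using finite_edges by (auto simp: S_def m_def card_cartesian_product card_Pow)
  have "card T = card (?C \<times> ?C \<times> Pow ?E)"
    unfolding T_def S_def by (rule bij_betw_same_card[OF bij_betw_eulerian_triples, symmetric])
  also have "\<dots> = 2 ^ nullity G * (2 ^ nullity G * 2 ^ m)"
    using finite_edges card_eulerian_subsets(2)[of ?E]
    by (simp add: card_cartesian_product card_Pow m_def nullity_def graph_rank_def)
  finally have card_T: "card T = 2 ^ nullity G * (2 ^ nullity G * 2 ^ m)" .
  then have "T \<noteq> {}" by (metis card.empty mult_eq_0_iff power_not_zero zero_neq_numeral)
  have "(\<Sum>t\<in>T. omega ^ total_size t) = of_real z"
    using sum_omega_eulerian_triples by (simp add: T_def S_def z_def)
  note cond = cond_bias_size_cong[OF S(1) T_def \<open>T \<noteq> {}\<close> this, folded random_triple_eq[folded S_def]]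
  have "(\<Sum>t\<in>S. omega ^ total_size t) = of_real ((-1) ^ m)"
    using sum_omega_triples by (simp add: S_def m_def)
  \<comment> \<open>The unconditional bias is the case of the sure event, with \<open>S\<close> in
    the role of \<open>T\<close>.\<close>
  from cond_bias_size_cong(2)[OF S(1) _ S(2) this, of "\<lambda>_. True", folded random_triple_eq[folded S_def]]
  have uncond: "bias (random_triple G) (size_cong 0) - bias (random_triple G) (size_cong 1)
      = 2 * (-1) ^ m / real (card S)"
    by (simp add: bias_eq_cond_bias)
  \<comment> \<open>One sign per edge turns the weights \<open>-1\<close> and \<open>2\<close> into
    the weights \<open>1\<close> and \<open>-2\<close> of the flow sum.\<close>
  have "(-1) ^ m * z = (\<Sum>X\<in>?C. \<Sum>Y\<in>?C. \<Prod>e\<in>?E. if e \<in> X \<or> e \<in> Y then 1 else -2)"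
    unfolding z_def m_def sum_distrib_left prod_constant[symmetric] prod.distrib[symmetric]
    by (intro sum.cong prod.cong) auto
  then have z: "(-1) ^ m * z = (-3) ^ nullity G * tutte G (-2) (-1/3)"
    by (simp add: flow_sum_eq_tutte)
  have "(2 * z / real (card T)) / (2 * (-1) ^ m / real (card S)) = 4 ^ graph_rank G * ((-1) ^ m * z)"
  proof -
    \<comment> \<open>With \<open>r\<close> the rank and \<open>n\<close> the nullity,
      \<open>m = r + n\<close>, so \<open>|S| = 2 ^ (3 * m)\<close> and
      \<open>|T| = 2 ^ (2 * n + m)\<close> have quotient \<open>2 ^ (2 * r)\<close>.\<close>
    have "real (card S) = 4 ^ graph_rank G * real (card T)"
      unfolding S(3) card_T m by (simp add: power_add) (simp flip: power_mult_distrib)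
    moreover have "(-1::real) ^ m * (-1) ^ m = 1" by (simp flip: power_mult_distrib)
    ultimately show ?thesis using \<open>T \<noteq> {}\<close> S(1)
      by (cases "even m") (auto simp: T_def field_simps)
  qed
  with cond uncond z show ?thesis by (simp add: mult.assoc)
qed

end
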